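(* Let $(X,d)$ be a compact totally disconnected metric space, $f:X\to2^X$ a multivalued map and $\varepsilon>0$. Then there is a multivalued map $g:X\to2^X$ with the shadowing property such that $d_H(f(x),g(x))<\varepsilon$ for all $x\in X$. Therefore, the multivalued maps with the shadowing property are dense in the collection of all multivalued maps $X\to 2^X$ with respect to the metric $d_H^\infty$.
   Context: $2^X$ is the set of non-empty closed subsets of $X$, with the Hausdorff metric $d_H$ induced by $d$. A multivalued map is an upper semicontinuous $f:X\to2^X$ (for every $x$ and open $U\supset f(x)$ there is an open neighborhood $V$ of $x$ with $f(y)\subset U$ for all $y\in V$). $d_H^\infty(f,g)=\sup_{x\in X}d_H(f(x),g(x))$. A multivalued map $g$ has the shadowing property if for each $\varepsilon>0$ there is $\delta>0$ such that for every sequence $\{x_i\}_{i\ge0}$ with $d(g(x_i),x_{i+1})<\delta$ for all $i$ (where $d(A,x)=\inf_{a\in A}d(a,x)$), there is a sequence $(y_i)_{i\ge0}$ with $y_{i+1}\in g(y_i)$ and $d(x_i,y_i)\le\varepsilon$ for all $i\ge0$. *)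

theory Defs
  imports "HOL-Analysis.Analysis"
begin

text \<open>The metric space \<open>X\<close> is the universe of a type of class \<open>metric_space\<close>.\<close>

definition totally_disconnected :: "'a::topological_space set \<Rightarrow> bool" where
  "totally_disconnected S \<longleftrightarrow> (\<forall>C. C \<subseteq> S \<and> connected C \<longrightarrow> (\<exists>a. C \<subseteq> {a}))"

text \<open>
  As for \<open>infdist\<close>, the value at the empty set is by convention 0; it plays no role for
  \<open>multivalued_map\<close>s, whose values are non-empty, but the locale \<open>Metric_space\<close> asks for
  non-negativity off the carrier as well.
\<close>

definition hausdorff_dist :: "'a::metric_space set \<Rightarrow> 'a set \<Rightarrow> real" where
  "hausdorff_dist A B =
     (if A = {} \<or> B = {} then 0 else max (SUP a\<in>A. infdist a B) (SUP b\<in>B. infdist b A))"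

definition upper_semicontinuous :: "('a::topological_space \<Rightarrow> 'b::topological_space set) \<Rightarrow> bool" where
  "upper_semicontinuous f \<longleftrightarrow>
     (\<forall>x U. open U \<and> f x \<subseteq> U \<longrightarrow> (\<exists>V. open V \<and> x \<in> V \<and> (\<forall>y\<in>V. f y \<subseteq> U)))"

definition multivalued_map :: "('a::metric_space \<Rightarrow> 'a set) \<Rightarrow> bool" where
  "multivalued_map f \<longleftrightarrow> (\<forall>x. closed (f x) \<and> f x \<noteq> {}) \<and> upper_semicontinuous f"

definition hausdorff_sup_dist :: "('a::metric_space \<Rightarrow> 'a set) \<Rightarrow> ('a \<Rightarrow> 'a set) \<Rightarrow> real" where
  "hausdorff_sup_dist f g = (SUP x. hausdorff_dist (f x) (g x))"

definition shadowing_property :: "('a::metric_space \<Rightarrow> 'a set) \<Rightarrow> bool" where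
  "shadowing_property g \<longleftrightarrow>
     (\<forall>\<epsilon>>0. \<exists>\<delta>>0. \<forall>x :: nat \<Rightarrow> 'a.
        (\<forall>i. infdist (x (Suc i)) (g (x i)) < \<delta>) \<longrightarrow>
        (\<exists>y :: nat \<Rightarrow> 'a. \<forall>i. y (Suc i) \<in> g (y i) \<and> dist (x i) (y i) \<le> \<epsilon>))"

text \<open>
  On a compact space \<open>hausdorff_sup_dist\<close> is a metric on the multivalued maps, so
  \<open>Metric_space.mtopology {f. multivalued_map f} hausdorff_sup_dist\<close> is the topology it induces.
\<close>

lemma infdist_le_hausdorff_dist:
  fixes A B :: "'a::metric_space set"
  assumes "bounded (UNIV :: 'a set)" "a \<in> A" "B \<noteq> {}"
  shows "infdist a B \<le> hausdorff_dist A B"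
proof -
  obtain K where K: "dist x y \<le> K" for x y :: 'a
    using assms(1) bounded_two_points[of "UNIV :: 'a set"] by auto
  have "bdd_above ((\<lambda>a. infdist a B) ` A)"
  proof (rule bdd_aboveI2)
    fix x obtain b where "b \<in> B" using assms by auto
    then show "infdist x B \<le> K" using infdist_le K order_trans by blast
  qed
  then have "infdist a B \<le> (SUP a\<in>A. infdist a B)"
    using assms(2) by (rule cSUP_upper2) auto
  moreover have "A \<noteq> {}" using assms(2) by auto
  ultimately show ?thesis using assms(3) by (simp add: hausdorff_dist_def)
qed

lemma hausdorff_dist_nonneg:
  fixes A B :: "'a::metric_space set"
  assumes "bounded (UNIV :: 'a set)"
  shows "0 \<le> hausdorff_dist A B"
proof (cases "A = {} \<or> B = {}")
  case False
  then obtain a where "a \<in> A" by auto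
  with infdist_le_hausdorff_dist[OF assms this] False show ?thesis
    by (meson infdist_nonneg order_trans)
qed (auto simp: hausdorff_dist_def)

lemma hausdorff_dist_le:
  assumes "A \<noteq> {}" "B \<noteq> {}"
    and "\<And>a. a \<in> A \<Longrightarrow> infdist a B \<le> c" "\<And>b. b \<in> B \<Longrightarrow> infdist b A \<le> c"
  shows "hausdorff_dist A B \<le> c"
  unfolding hausdorff_dist_def using assms by (auto intro!: cSUP_least)

lemma hausdorff_dist_commute: "hausdorff_dist A B = hausdorff_dist B A"
  by (auto simp: hausdorff_dist_def max.commute)

lemma hausdorff_dist_triangle:
  fixes A B C :: "'a::metric_space set"
  assumes bd: "bounded (UNIV :: 'a set)" and ne: "A \<noteq> {}" "B \<noteq> {}" "C \<noteq> {}"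
  shows "hausdorff_dist A C \<le> hausdorff_dist A B + hausdorff_dist B C"
proof -
  have *: "infdist a C \<le> hausdorff_dist A B + hausdorff_dist B C"
    if a: "a \<in> A" and ne: "B \<noteq> {}" "C \<noteq> {}" for a and A B C :: "'a set"
  proof -
    have "infdist a C - hausdorff_dist B C \<le> dist a b" if "b \<in> B" for b
      using infdist_triangle[of a C b] infdist_le_hausdorff_dist[OF bd that ne(2)] by linarith
    then have "infdist a C - hausdorff_dist B C \<le> infdist a B"
      unfolding infdist_notempty[OF ne(1)] using ne(1) by (intro cINF_greatest)
    then show ?thesis using infdist_le_hausdorff_dist[OF bd a ne(1)] by linarith
  qed
  show ?thesis
  proof (rule hausdorff_dist_le)
    fix c assume "c \<in> C"
    from *[OF this ne(2,1)] show "infdist c A \<le> hausdorff_dist A B + hausdorff_dist B C"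
      by (simp add: hausdorff_dist_commute add.commute)
  qed (use * ne in auto)
qed

lemma Metric_space_hausdorff_sup_dist:
  assumes "compact (UNIV :: 'a::metric_space set)"
  shows "Metric_space {f :: 'a \<Rightarrow> 'a set. multivalued_map f} hausdorff_sup_dist"
proof -
  have bd: "bounded (UNIV :: 'a set)" using assms by (rule compact_imp_bounded)
  obtain K where K: "dist x y \<le> K" for x y :: 'a
    using bd bounded_two_points[of "UNIV :: 'a set"] by auto
  have "0 \<le> K" using K[of undefined undefined] by simp
  then have infK: "infdist x B \<le> K" for x and B :: "'a set"
    using infdist_le[of _ B x] K by (cases "B = {}") (auto simp: infdist_def[of x "{}"] intro: order_trans)
  then have hdK: "hausdorff_dist A B \<le> K" for A B :: "'a set"
    using \<open>0 \<le> K\<close> hausdorff_dist_le[of A B K] by (cases "A = {} \<or> B = {}") (auto simp: hausdorff_dist_def)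
  have ne: "f x \<noteq> {}" and cl: "closed (f x)" if "multivalued_map f" for f :: "'a \<Rightarrow> 'a set" and x
    using that by (auto simp: multivalued_map_def)
  have le: "hausdorff_dist (f x) (g x) \<le> hausdorff_sup_dist f g" for f g :: "'a \<Rightarrow> 'a set" and x
    unfolding hausdorff_sup_dist_def using hdK by (intro cSUP_upper bdd_aboveI2[of _ _ K]) auto
  have sub: "f x \<subseteq> g x" if "multivalued_map f" "multivalued_map g" "hausdorff_sup_dist f g = 0"
    for f g :: "'a \<Rightarrow> 'a set" and x
  proof
    fix a assume "a \<in> f x"
    from infdist_le_hausdorff_dist[OF bd this ne[OF that(2), of x]] le[of f x g]
    have "infdist a (g x) = 0" using that(3) infdist_nonneg[of a "g x"] by linarith
    then show "a \<in> g x" using in_closed_iff_infdist_zero[OF cl[OF that(2)] ne[OF that(2)]] by blast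
  qed
  have comm: "hausdorff_sup_dist f g = hausdorff_sup_dist g f" for f g :: "'a \<Rightarrow> 'a set"
    by (simp add: hausdorff_sup_dist_def hausdorff_dist_commute)
  show ?thesis
  proof (unfold_locales, simp_all)
    fix f g :: "'a \<Rightarrow> 'a set"
    show "0 \<le> hausdorff_sup_dist f g"
      using hausdorff_dist_nonneg[OF bd] le order_trans by blast
    show "hausdorff_sup_dist f g = hausdorff_sup_dist g f" by (rule comm)
  next
    fix f g :: "'a \<Rightarrow> 'a set" assume fg: "multivalued_map f" "multivalued_map g"
    show "(hausdorff_sup_dist f g = 0) = (f = g)"
    proof
      assume "hausdorff_sup_dist f g = 0"
      then show "f = g" using sub fg comm by (metis ext subset_antisym)
    next
      assume "f = g"
      have "hausdorff_dist (f x) (f x) = 0" for x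
        using ne[OF fg(1), of x] by (simp add: hausdorff_dist_def)
      with \<open>f = g\<close> show "hausdorff_sup_dist f g = 0" by (simp add: hausdorff_sup_dist_def)
    qed
  next
    fix f g h :: "'a \<Rightarrow> 'a set" assume fgh: "multivalued_map f" "multivalued_map g" "multivalued_map h"
    show "hausdorff_sup_dist f h \<le> hausdorff_sup_dist f g + hausdorff_sup_dist g h"
      unfolding hausdorff_sup_dist_def[of f h]
    proof (rule cSUP_least)
      fix x
      have "hausdorff_dist (f x) (h x) \<le> hausdorff_dist (f x) (g x) + hausdorff_dist (g x) (h x)"
        using fgh by (intro hausdorff_dist_triangle bd ne)
      then show "hausdorff_dist (f x) (h x) \<le> hausdorff_sup_dist f g + hausdorff_sup_dist g h"
        using le[of f x g] le[of g x h] by linarith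
    qed simp
  qed
qed

end

theory Submission
  imports Defs
begin

text \<open>
  In a compact totally disconnected space there are finite clopen partitions of arbitrarily small
  mesh. Let \<open>g x\<close> be the union of the cells that meet \<open>f x\<close>. Then \<open>g\<close> is upper semicontinuous
  because \<open>g x\<close> is an open superset of \<open>f x\<close> that is saturated by cells. The cells are separated by
  a uniform gap \<open>\<delta>\<close>, so every \<open>\<delta>\<close>-pseudo-orbit of \<open>g\<close> is already an orbit.
\<close>

text \<open>Connected sets have at most one point, so none meets both \<open>{x}\<close> and
  \<open>- W\<close>. In a compact Hausdorff space, closed sets that no connected set joins are
  separated by a clopen set.\<close>

lemma clopen_neighbourhood:
  fixes x :: "'a::metric_space"
  assumes "compact (UNIV :: 'a set)" "totally_disconnected (UNIV :: 'a set)" "open W" "x \<in> W"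
  obtains U where "open U" "closed U" "x \<in> U" "U \<subseteq> W"
proof -
  have "separated_between (euclidean :: 'a topology) {x} (- W)"
  proof (rule cut_wire_fence_theorem)
    show "compact_space (euclidean :: 'a topology)"
      using assms(1) by (simp add: compact_space_def)
    fix C :: "'a set" assume "connectedin euclidean C"
    then obtain a where "C \<subseteq> {a}"
      using assms(2) by (auto simp: totally_disconnected_def)
    then show "disjnt C {x} \<or> disjnt C (- W)"
      using \<open>x \<in> W\<close> by (auto simp: disjnt_def)
  qed (use assms(3) in \<open>auto simp: closed_Compl\<close>)
  then obtain U V where UV: "open U" "open V" "U \<union> V = UNIV" "disjnt U V" "x \<in> U" "- W \<subseteq> V"
    by (auto simp: separated_between_def)
  then have "U = - V" by (auto simp: disjnt_def)
  then show thesis using that[of U] UV by auto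
qed

text \<open>The fibres of \<open>c\<close> are the cells of a clopen partition.\<close>

lemma small_clopen_partition:
  fixes e :: real
  assumes "compact (UNIV :: 'a::metric_space set)" "totally_disconnected (UNIV :: 'a set)" "e > 0"
  obtains c :: "'a::metric_space \<Rightarrow> 'a set set"
  where "\<And>K. open (c -` K)" "\<And>x y. c x = c y \<Longrightarrow> dist x y < e"
proof -
  have "\<exists>U. open U \<and> closed U \<and> x \<in> U \<and> U \<subseteq> ball x (e/2)" for x :: 'a
    by (rule clopen_neighbourhood[OF assms(1,2), of "ball x (e/2)" x]) (use \<open>e > 0\<close> in auto)
  then obtain U where U: "open (U x)" "closed (U x)" "x \<in> U x" "U x \<subseteq> ball x (e/2)" for x :: 'a
    by metis
  obtain N where N: "N \<subseteq> UNIV" "finite N" "UNIV \<subseteq> (\<Union>z\<in>N. U z)"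
  proof (rule compactE_image[OF assms(1)])
    show "open (U z)" if "z \<in> UNIV" for z using U(1) .
    show "UNIV \<subseteq> (\<Union>z\<in>UNIV. U z)" using U(3) by blast
  qed
  \<comment> \<open>The label of a point records which sets of the finite clopen cover contain it;
    the non-empty fibres are the atoms of the Boolean algebra generated by the cover.\<close>
  define c where "c x = {V \<in> U ` N. x \<in> V}" for x
  show thesis
  proof (rule that[of c])
    fix K
    have cell: "open (c -` {c x})" for x
    proof -
      have "c y = c x \<longleftrightarrow> (\<forall>z\<in>N. y \<in> U z \<longleftrightarrow> x \<in> U z)" for y
        unfolding c_def by blast
      then have "c -` {c x} = (\<Inter>z\<in>N. {y. y \<in> U z \<longleftrightarrow> x \<in> U z})"
        by (simp add: vimage_def INTER_eq)
      also have "open \<dots>"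
      \<comment> \<open>Each factor is \<open>U z\<close> or its complement, both open, and
        \<open>N\<close> is finite.\<close>
      proof (intro open_INT N(2) ballI)
        fix z show "open {y. y \<in> U z \<longleftrightarrow> x \<in> U z}"
          using U(1)[of z] U(2)[of z] by (cases "x \<in> U z") (simp_all add: closed_def Compl_eq)
      qed
      finally show ?thesis .
    qed
    have "open (\<Union>x\<in>c -` K. c -` {c x})" using cell by (intro open_UN) simp
    also have "(\<Union>x\<in>c -` K. c -` {c x}) = c -` K" by auto
    finally show "open (c -` K)" .
  next
    fix x y assume eq: "c x = c y"
    \<comment> \<open>Since \<open>N\<close> covers, the common label contains some
      \<open>U z\<close>, which lies in a ball of radius \<open>e/2\<close>.\<close>
    obtain z where z: "z \<in> N" "x \<in> U z" using N(3) by blast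
    then have "U z \<in> c x" by (auto simp: c_def)
    then have "y \<in> U z" using eq by (auto simp: c_def)
    then have "dist z x < e/2" "dist z y < e/2" using z U(4)[of z] by auto
    then show "dist x y < e" using dist_triangle_half_r by blast
  qed
qed

text \<open>The fibres of \<open>c\<close> form an open cover, and \<open>d\<close> is a Lebesgue
  number of it.\<close>

lemma locally_constant_uniform_gap:
  fixes c :: "'a::metric_space \<Rightarrow> 'b"
  assumes "compact (UNIV :: 'a set)" "\<And>K. open (c -` K)"
  obtains d where "d > 0" "\<And>x y. dist x y < d \<Longrightarrow> c x = c y"
proof -
  obtain d where d: "d > 0" "\<And>x. \<exists>G\<in>range (\<lambda>k. c -` {k}). ball x d \<subseteq> G"
  proof (rule Heine_Borel_lemma[OF assms(1), of "range (\<lambda>k. c -` {k})"])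
    show "UNIV \<subseteq> (\<Union>k. c -` {k})" by auto
    show "open G" if "G \<in> range (\<lambda>k. c -` {k})" for G using that assms(2) by blast
  qed blast
  show thesis
  proof
    fix x y :: 'a assume "dist x y < d"
    obtain k where "ball x d \<subseteq> c -` {k}" using d(2)[of x] by auto
    then show "c x = c y" using \<open>dist x y < d\<close> \<open>d > 0\<close>
      by (metis centre_in_ball mem_ball singletonD subsetD vimageD)
  qed (rule d(1))
qed

lemma multivalued_map_saturation:
  fixes c :: "'a::metric_space \<Rightarrow> 'b"
  assumes f: "multivalued_map f" and c: "\<And>K. open (c -` K)"
  shows "multivalued_map (\<lambda>x. c -` c ` f x)"
  unfolding multivalued_map_def upper_semicontinuous_def
proof (intro conjI allI impI)
  fix x
  show "closed (c -` c ` f x)"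
    \<comment> \<open>The complement of a saturated set is saturated, hence open.\<close>
    using c[of "- c ` f x"] by (simp add: closed_def vimage_Compl)
  show "c -` c ` f x \<noteq> {}" using f by (auto simp: multivalued_map_def)
next
  fix x U assume U: "open U \<and> c -` c ` f x \<subseteq> U"
  \<comment> \<open>Semicontinuity of \<open>f\<close> is applied to the saturation of
    \<open>f x\<close> instead of \<open>U\<close>: once \<open>f y\<close> lies in a saturated set,
    so does its saturation.\<close>
  have "f x \<subseteq> c -` c ` f x" by auto
  then obtain V where V: "open V" "x \<in> V" "\<forall>y\<in>V. f y \<subseteq> c -` c ` f x"
    using f c[of "c ` f x"] unfolding multivalued_map_def upper_semicontinuous_def by metis
  have "c -` c ` f y \<subseteq> U" if "y \<in> V" for y
  proof -
    have "c ` f y \<subseteq> c ` f x" using V(3) that by (simp add: image_subset_iff_subset_vimage)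
    then have "c -` c ` f y \<subseteq> c -` c ` f x" by (rule vimage_mono)
    then show ?thesis using U by (rule subset_trans[OF _ conjunct2])
  qed
  then show "\<exists>V. open V \<and> x \<in> V \<and> (\<forall>y\<in>V. c -` c ` f y \<subseteq> U)"
    using V(1,2) by (intro exI[of _ V]) simp
qed

lemma shadowing_property_saturation:
  fixes c :: "'a::metric_space \<Rightarrow> 'b"
  assumes "compact (UNIV :: 'a set)" "\<And>K. open (c -` K)" "\<And>x. f x \<noteq> {}"
  shows "shadowing_property (\<lambda>x. c -` c ` f x)"
proof -
  obtain d where d: "d > 0" "\<And>x y. dist x y < d \<Longrightarrow> c x = c y"
    using locally_constant_uniform_gap[OF assms(1,2)] by blast
  have orbit: "y \<in> c -` c ` A" if A: "A \<noteq> {}" "infdist y (c -` c ` A) < d" for y and A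
  proof -
    \<comment> \<open>\<open>infdist\<close> to the empty set is 0 by convention, so only for a
      non-empty set does the bound yield a point within \<open>d\<close>, which then has the same
      label as \<open>y\<close>.\<close>
    have ne: "c -` c ` A \<noteq> {}" using A(1) by auto
    then obtain z where "z \<in> c -` c ` A" "dist y z < d"
      using A(2) by (auto simp: infdist_notempty cINF_less_iff)
    then show ?thesis using d(2) by fastforce
  qed
  show ?thesis
    unfolding shadowing_property_def
  \<comment> \<open>One gap \<open>d\<close> serves every tolerance \<open>e\<close>, because the
    pseudo-orbit shadows itself.\<close>
  proof (intro allI impI exI[of _ d] conjI)
    fix e :: real and x :: "nat \<Rightarrow> 'a"
    assume e: "0 < e" and x: "\<forall>i. infdist (x (Suc i)) (c -` c ` f (x i)) < d"
    have "x (Suc i) \<in> c -` c ` f (x i)" for i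
      by (rule orbit[OF assms(3)]) (use x in blast)
    moreover have "dist (x i) (x i) \<le> e" for i using e by simp
    ultimately show "\<exists>y. \<forall>i. y (Suc i) \<in> c -` c ` f (y i) \<and> dist (x i) (y i) \<le> e"
      by blast
  qed (rule d(1))
qed

text \<open>Points of \<open>A\<close> lie in its saturation, and each point of the saturation
  shares a cell with a point of \<open>A\<close>.\<close>

lemma hausdorff_dist_saturation_le:
  fixes c :: "'a::metric_space \<Rightarrow> 'b"
  assumes "\<And>x y. c x = c y \<Longrightarrow> dist x y < e" "A \<noteq> {}"
  shows "hausdorff_dist A (c -` c ` A) \<le> e"
proof (rule hausdorff_dist_le)
  have "0 < e" using assms(1)[OF refl] by simp
  then show "infdist a (c -` c ` A) \<le> e" if "a \<in> A" for a
    using that by (intro infdist_le2[of a]) auto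
  fix b assume "b \<in> c -` c ` A"
  then obtain a where "a \<in> A" "c b = c a" by auto
  then show "infdist b A \<le> e" using assms(1) by (intro infdist_le2[of a]) (auto intro: less_imp_le)
qed (use assms(2) in auto)

lemma shadowing_approximation:
  fixes f :: "'a::metric_space \<Rightarrow> 'a set"
  assumes "compact (UNIV :: 'a set)" "totally_disconnected (UNIV :: 'a set)"
    and "multivalued_map f" "e > 0"
  obtains g where "multivalued_map g" "shadowing_property g" "\<And>x. hausdorff_dist (f x) (g x) \<le> e"
proof -
  obtain c :: "'a \<Rightarrow> 'a set set"
    where c: "\<And>K. open (c -` K)" "\<And>x y. c x = c y \<Longrightarrow> dist x y < e"
    using small_clopen_partition[OF assms(1,2,4)] by blast
  have ne: "f x \<noteq> {}" for x using assms(3) by (simp add: multivalued_map_def)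
  show thesis
  proof
    show "multivalued_map (\<lambda>x. c -` c ` f x)"
      by (rule multivalued_map_saturation[OF assms(3) c(1)])
    show "shadowing_property (\<lambda>x. c -` c ` f x)"
      by (rule shadowing_property_saturation[OF assms(1) c(1) ne])
    show "hausdorff_dist (f x) (c -` c ` f x) \<le> e" for x
      by (rule hausdorff_dist_saturation_le[OF c(2) ne])
  qed
qed

theorem theorem7p4:
  assumes "compact (UNIV :: 'a::metric_space set)"
    and "totally_disconnected (UNIV :: 'a set)"
  shows "(\<forall>f :: 'a \<Rightarrow> 'a set. \<forall>\<epsilon>>0. multivalued_map f \<longrightarrow>
            (\<exists>g. multivalued_map g \<and> shadowing_property g \<and>
                 (\<forall>x. hausdorff_dist (f x) (g x) < \<epsilon>)))
       \<and> Metric_space.mtopology {f :: 'a \<Rightarrow> 'a set. multivalued_map f} hausdorff_sup_dist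
            closure_of {g. multivalued_map g \<and> shadowing_property g}
          = {f. multivalued_map f}"
proof -
  interpret Metric_space "{f :: 'a \<Rightarrow> 'a set. multivalued_map f}" hausdorff_sup_dist
    by (rule Metric_space_hausdorff_sup_dist[OF assms(1)])
  have approx: "\<exists>g. multivalued_map g \<and> shadowing_property g \<and>
      (\<forall>x. hausdorff_dist (f x) (g x) < e) \<and> hausdorff_sup_dist f g < e"
    if f: "multivalued_map f" and e: "e > 0" for f :: "'a \<Rightarrow> 'a set" and e
  proof -
    \<comment> \<open>Halving \<open>e\<close> keeps the inequality strict after the supremum over
      \<open>x\<close>.\<close>
    obtain g where g: "multivalued_map g" "shadowing_property g"
      and le: "\<And>x. hausdorff_dist (f x) (g x) \<le> e/2"
      using shadowing_approximation[OF assms f, of "e/2"] e by auto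
    have "hausdorff_dist (f x) (g x) < e" for x
      using le[of x] e by linarith
    moreover have "hausdorff_sup_dist f g \<le> e/2"
      unfolding hausdorff_sup_dist_def using le by (intro cSUP_least) auto
    ultimately show ?thesis using g e by (intro exI[of _ g]) auto
  qed
  have "mtopology closure_of {g. multivalued_map g \<and> shadowing_property g}
      = {f :: 'a \<Rightarrow> 'a set. multivalued_map f}"
  proof (intro equalityI subsetI)
    fix f :: "'a \<Rightarrow> 'a set" assume "f \<in> {f. multivalued_map f}"
    then have f: "multivalued_map f" by simp
    \<comment> \<open>Density amounts to every ball around \<open>f\<close> containing such a
      \<open>g\<close>; this uses the bound on \<open>hausdorff_sup_dist\<close>.\<close>
    have "\<exists>g\<in>{g. multivalued_map g \<and> shadowing_property g}. g \<in> mball f r" if "r > 0" for r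
      using approx[OF f that] f unfolding in_mball by auto
    then show "f \<in> mtopology closure_of {g. multivalued_map g \<and> shadowing_property g}"
      using f unfolding metric_closure_of by simp
  qed (simp add: metric_closure_of)
  moreover have "\<exists>g. multivalued_map g \<and> shadowing_property g \<and> (\<forall>x. hausdorff_dist (f x) (g x) < e)"
    if "multivalued_map f" "e > 0" for f :: "'a \<Rightarrow> 'a set" and e
    using approx[OF that] by auto
  ultimately show ?thesis by simp
qed

end
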